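(* Let $\mathcal M\subset\mathbb R^D$ be a manifold, $\mathcal C_1,\dots,\mathcal C_k$ disjoint subsets of $\mathcal M$, $V=\bigcup_i\mathcal C_i$ and $G=\mathcal M\setminus V$. Suppose $X_1,\dots,X_n$ are drawn i.i.d. from a density supported on $\mathcal M$ that is constant on $V$ with value $f_V$ and constant on $G$ with value $f_G$. Consider the null hypothesis of a uniform distribution on the manifold, $H_0: f_G=f_V$, against the alternative $H_1: f_G=(1-\delta)f_V$ for $\delta=\delta_n>0$. Then no test can separate the two cases consistently if $n\delta^2\nrightarrow\infty$ as $n\to\infty$; that is, if $n\delta_n^2\not\to\infty$, there is no sequence of tests (the $n$-th based on $X_1,\dots,X_n$) for which both the type I error probability under $H_0$ and the type II error probability under $H_1$ tend to $0$ as $n\to\infty$.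
   Context: Densities are with respect to the volume measure of $\mathcal M$, which is assumed to have finite positive total volume so that the uniform distribution exists; $\mathcal M$ and the sets $\mathcal C_i$ (measurable) do not depend on $n$, while the depth $\delta$ may depend on $n$ (with $f_G\ge 0$, i.e. $\delta\le1$). *)

theory Defs
  imports "HOL-Probability.Probability"
begin

section \<open>Embedded submanifolds of Euclidean space\<close>

definition C1_on :: "'a::real_normed_vector set \<Rightarrow> ('a \<Rightarrow> 'b::real_normed_vector) \<Rightarrow> bool" where
  "C1_on U f \<longleftrightarrow> (\<exists>f' :: 'a \<Rightarrow> 'a \<Rightarrow>\<^sub>L 'b. continuous_on U f' \<and>
     (\<forall>x\<in>U. (f has_derivative blinfun_apply (f' x)) (at x)))"

definition C1_diffeomorphism ::
  "'a::real_normed_vector set \<Rightarrow> 'b::real_normed_vector set \<Rightarrow> ('a \<Rightarrow> 'b) \<Rightarrow> ('b \<Rightarrow> 'a) \<Rightarrow> bool" where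
  "C1_diffeomorphism U V h g \<longleftrightarrow>
     open U \<and> open V \<and> homeomorphism U V h g \<and> C1_on U h \<and> C1_on V g"

text \<open>A \<open>d\<close>-dimensional submanifold, without boundary, is locally straightened to a
  \<open>d\<close>-dimensional linear subspace by an ambient diffeomorphism. Only \<open>C\<^sup>1\<close> regularity is
  required, so all smoother submanifolds are covered.\<close>

definition embedded_submanifold :: "nat \<Rightarrow> 'a::euclidean_space set \<Rightarrow> bool" where
  "embedded_submanifold d M \<longleftrightarrow>
     (\<forall>p\<in>M. \<exists>U V h g (S :: 'a set). p \<in> U \<and> C1_diffeomorphism U V h g \<and>
        subspace S \<and> dim S = d \<and> h ` (U \<inter> M) = V \<inter> S)"


section \<open>The volume measure\<close>

text \<open>The \<open>d\<close>-dimensional volume of a subset of Euclidean space is its Hausdorff measure,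
  normalised so that it agrees with Lebesgue measure on \<open>d\<close>-dimensional subspaces:
  a set of diameter \<open>\<rho>\<close> is charged the volume of a \<open>d\<close>-ball of that diameter. On a
  \<open>d\<close>-dimensional submanifold it is the Riemannian volume of the induced metric.
  For \<open>d = 0\<close> it is counting measure, since \<open>0 ^ 0 = 1\<close>.\<close>

definition ball_cost :: "nat \<Rightarrow> 'a::metric_space set \<Rightarrow> ennreal" where
  "ball_cost d E =
     (if E = {} then 0 else ennreal (unit_ball_vol (real d) * (diameter E / 2) ^ d))"

definition hausdorff_pre :: "nat \<Rightarrow> real \<Rightarrow> 'a::metric_space set \<Rightarrow> ennreal" where
  "hausdorff_pre d r A =
     (INF E\<in>{E :: nat \<Rightarrow> 'a set. A \<subseteq> (\<Union>i. E i) \<and> (\<forall>i. bounded (E i) \<and> diameter (E i) \<le> r)}.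
        \<Sum>i. ball_cost d (E i))"

definition hausdorff_outer :: "nat \<Rightarrow> 'a::metric_space set \<Rightarrow> ennreal" where
  "hausdorff_outer d A = (SUP r\<in>{0<..}. hausdorff_pre d r A)"

definition volume_measure :: "nat \<Rightarrow> 'a::metric_space set \<Rightarrow> 'a measure" where
  "volume_measure d M = measure_of M (sets (restrict_space borel M)) (hausdorff_outer d)"

text \<open>\<open>measure_of\<close> yields the zero measure unless the given set function is countably
  additive; the lemma \<open>emeasure_volume_measure\<close> below rules this out, for every \<open>M\<close>.\<close>

lemma ball_cost_empty [simp]: "ball_cost d {} = 0"
  by (simp add: ball_cost_def)

lemma hausdorff_pre_le:
  assumes "A \<subseteq> (\<Union>i. E i)" "\<And>i. bounded (E i)" "\<And>i. diameter (E i) \<le> r"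
  shows "hausdorff_pre d r A \<le> (\<Sum>i. ball_cost d (E i))"
  unfolding hausdorff_pre_def using assms by (intro INF_lower) auto

lemma hausdorff_pre_antimono:
  assumes "A \<subseteq> B" "r \<le> s"
  shows "hausdorff_pre d s A \<le> hausdorff_pre d r B"
  unfolding hausdorff_pre_def
proof (rule INF_superset_mono)
  show "{E. B \<subseteq> (\<Union>i. E i) \<and> (\<forall>i. bounded (E i) \<and> diameter (E i) \<le> r)}
      \<subseteq> {E. A \<subseteq> (\<Union>i. E i) \<and> (\<forall>i. bounded (E i) \<and> diameter (E i) \<le> s)}"
    using assms by (blast intro: order_trans)
qed simp

lemma hausdorff_pre_countably_subadditive:
  "hausdorff_pre d r (\<Union>n. A n) \<le> (\<Sum>n. hausdorff_pre d r (A n))"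
proof (rule ennreal_le_epsilon)
  fix e :: real assume e: "0 < e" and fin: "(\<Sum>n. hausdorff_pre d r (A n)) < top"
  have "\<exists>E. A n \<subseteq> (\<Union>i. E i) \<and> (\<forall>i. bounded (E i) \<and> diameter (E i) \<le> r) \<and>
      (\<Sum>i. ball_cost d (E i)) < hausdorff_pre d r (A n) + ennreal (e * (1/2)^Suc n)" for n
  proof -
    have "hausdorff_pre d r (A n) < top"
      using fin by (rule ennreal_suminf_lessD)
    then have "hausdorff_pre d r (A n) < hausdorff_pre d r (A n) + ennreal (e * (1/2)^Suc n)"
      using e by (simp add: less_top)
    then show ?thesis
      unfolding hausdorff_pre_def INF_less_iff by blast
  qed
  then obtain E where cov: "\<And>n. A n \<subseteq> (\<Union>i. E n i)"
    and bd: "\<And>n i. bounded (E n i)" and diam: "\<And>n i. diameter (E n i) \<le> r"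
    and cost: "\<And>n. (\<Sum>i. ball_cost d (E n i)) < hausdorff_pre d r (A n) + ennreal (e * (1/2)^Suc n)"
    by metis
  define F where "F k = case_prod E (prod_decode k)" for k
  have "(\<Union>n. A n) \<subseteq> (\<Union>k. F k)"
  proof
    fix x assume "x \<in> (\<Union>n. A n)"
    then obtain n i where "x \<in> E n i"
      using cov by blast
    then have "x \<in> F (prod_encode (n, i))"
      by (simp add: F_def)
    then show "x \<in> (\<Union>k. F k)"
      by blast
  qed
  then have "hausdorff_pre d r (\<Union>n. A n) \<le> (\<Sum>k. ball_cost d (F k))"
    by (rule hausdorff_pre_le) (auto simp: F_def bd diam split: prod.split)
  also have "\<dots> = (\<Sum>n. \<Sum>i. ball_cost d (E n i))"
    using suminf_ennreal_2dimen[of "\<lambda>n. \<Sum>i. ball_cost d (E n i)" "\<lambda>(n, i). ball_cost d (E n i)"]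
    by (simp add: F_def comp_def split_def)
  also have "\<dots> \<le> (\<Sum>n. hausdorff_pre d r (A n) + ennreal (e * (1/2)^Suc n))"
    using cost by (intro suminf_le summableI) (auto intro: less_imp_le)
  also have "\<dots> = (\<Sum>n. hausdorff_pre d r (A n)) + (\<Sum>n. ennreal (e * (1/2)^Suc n))"
    by (rule suminf_add[symmetric]) (auto intro: summableI)
  also have "(\<Sum>n. ennreal (e * (1/2)^Suc n)) = ennreal e"
  proof (rule suminf_ennreal_eq)
    show "(\<lambda>n. e * (1/2)^Suc n) sums e"
      using sums_mult[OF power_half_series, of e] by (simp only: mult_1_right)
  qed (use e in simp)
  finally show "hausdorff_pre d r (\<Union>n. A n) \<le> (\<Sum>n. hausdorff_pre d r (A n)) + ennreal e" .
qed

lemma outer_measure_space_hausdorff: "outer_measure_space (Pow M) (hausdorff_outer d)"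
  unfolding outer_measure_space_def
proof (intro conjI)
  have "hausdorff_pre d r {} = 0" if "0 < r" for r
    using hausdorff_pre_le[of "{}" "\<lambda>_. {}" r d] that by (auto simp: le_zero_eq)
  then show "positive (Pow M) (hausdorff_outer d)"
    by (auto simp: positive_def hausdorff_outer_def intro!: SUP_eqI)
  show "increasing (Pow M) (hausdorff_outer d)"
    by (auto simp: increasing_def hausdorff_outer_def intro!: SUP_subset_mono hausdorff_pre_antimono)
  show "countably_subadditive (Pow M) (hausdorff_outer d)"
    unfolding countably_subadditive_def
  proof (intro allI impI)
    fix A :: "nat \<Rightarrow> 'a set"
    show "hausdorff_outer d (\<Union>i. A i) \<le> (\<Sum>i. hausdorff_outer d (A i))"
      unfolding hausdorff_outer_def
    proof (rule SUP_least)
      fix r :: real assume "r \<in> {0<..}"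
      then show "hausdorff_pre d r (\<Union>i. A i) \<le> (\<Sum>i. SUP r\<in>{0<..}. hausdorff_pre d r (A i))"
        by (intro order_trans[OF hausdorff_pre_countably_subadditive] suminf_le summableI)
           (auto intro: SUP_upper)
    qed
  qed
qed

lemma hausdorff_pre_separated:
  assumes "r < e" "\<And>x y. x \<in> A \<Longrightarrow> y \<in> B \<Longrightarrow> e \<le> dist x y"
  shows "hausdorff_pre d r A + hausdorff_pre d r B \<le> hausdorff_pre d r (A \<union> B)"
proof -
  have "hausdorff_pre d r A + hausdorff_pre d r B \<le> (\<Sum>i. ball_cost d (E i))"
    if cov: "A \<union> B \<subseteq> (\<Union>i. E i)" and bd: "\<And>i. bounded (E i)" and diam: "\<And>i. diameter (E i) \<le> r"
    for E
  proof -
    have sep: "E i \<inter> A = {} \<or> E i \<inter> B = {}" for i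
    proof (rule ccontr)
      assume "\<not> ?thesis"
      then obtain x y where "x \<in> E i" "x \<in> A" "y \<in> E i" "y \<in> B"
        by blast
      then show False
        using assms diameter_bounded_bound[OF bd, of x i y] diam[of i] by (smt (verit))
    qed
    have r: "0 \<le> r"
      using diam[of 0] diameter_ge_0[OF bd, of 0] by linarith
    define EA where "EA i = (if E i \<inter> A = {} then {} else E i)" for i
    define EB where "EB i = (if E i \<inter> B = {} then {} else E i)" for i
    have "hausdorff_pre d r A \<le> (\<Sum>i. ball_cost d (EA i))"
      using cov by (intro hausdorff_pre_le) (fastforce simp: EA_def bd diam r)+
    moreover have "hausdorff_pre d r B \<le> (\<Sum>i. ball_cost d (EB i))"
      using cov by (intro hausdorff_pre_le) (fastforce simp: EB_def bd diam r)+
    ultimately have "hausdorff_pre d r A + hausdorff_pre d r B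
        \<le> (\<Sum>i. ball_cost d (EA i)) + (\<Sum>i. ball_cost d (EB i))"
      by (rule add_mono)
    also have "\<dots> = (\<Sum>i. ball_cost d (EA i) + ball_cost d (EB i))"
      by (rule suminf_add) (auto intro: summableI)
    also have "\<dots> \<le> (\<Sum>i. ball_cost d (E i))"
      using sep by (intro suminf_le summableI) (auto simp: EA_def EB_def)
    finally show ?thesis .
  qed
  then show ?thesis
    unfolding hausdorff_pre_def[of d r "A \<union> B"] by (intro INF_greatest) auto
qed

lemma hausdorff_outer_separated:
  assumes "0 < e" "\<And>x y. x \<in> A \<Longrightarrow> y \<in> B \<Longrightarrow> e \<le> dist x y"
  shows "hausdorff_outer d A + hausdorff_outer d B \<le> hausdorff_outer d (A \<union> B)"
proof -
  have "hausdorff_pre d r A + hausdorff_pre d s B \<le> hausdorff_outer d (A \<union> B)"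
    if "0 < r" "0 < s" for r s
  proof -
    define t where "t = min (min r s) (e / 2)"
    have t: "0 < t" "t \<le> r" "t \<le> s" "t < e"
      using that \<open>0 < e\<close> by (auto simp: t_def min_def)
    have "hausdorff_pre d r A + hausdorff_pre d s B \<le> hausdorff_pre d t A + hausdorff_pre d t B"
      using t by (intro add_mono hausdorff_pre_antimono) auto
    also have "\<dots> \<le> hausdorff_pre d t (A \<union> B)"
      using t assms by (intro hausdorff_pre_separated[of _ e]) auto
    also have "\<dots> \<le> hausdorff_outer d (A \<union> B)"
      unfolding hausdorff_outer_def using t by (intro SUP_upper) auto
    finally show ?thesis .
  qed
  then show ?thesis
    unfolding hausdorff_outer_def[of d A] hausdorff_outer_def[of d B]
    by (subst ennreal_SUP_add_left[symmetric], force, subst ennreal_SUP_add_right, force)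
       (auto intro!: SUP_least)
qed

lemma closed_in_lambda_system:
  fixes \<mu> :: "'a::metric_space set \<Rightarrow> ennreal"
  assumes oms: "outer_measure_space (Pow M) \<mu>"
    and separated: "\<And>A B e. 0 < e \<Longrightarrow> (\<And>x y. x \<in> A \<Longrightarrow> y \<in> B \<Longrightarrow> e \<le> dist x y) \<Longrightarrow>
      \<mu> A + \<mu> B \<le> \<mu> (A \<union> B)"
    and "closed F"
  shows "M \<inter> F \<in> lambda_system M (Pow M) \<mu>"
proof (cases "F = {}")
  case True
  then show ?thesis
    using oms by (simp add: lambda_system_def outer_measure_space_def positive_def Int_absorb1)
next
  case False
  have mono: "\<mu> A \<le> \<mu> B" if "A \<subseteq> B" "B \<subseteq> M" for A B
    using oms that by (auto simp: outer_measure_space_def increasing_def)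
  have empty: "\<mu> {} = 0"
    using oms by (simp add: outer_measure_space_def positive_def)
  have csub: "\<mu> (\<Union>i. A i) \<le> (\<Sum>i. \<mu> (A i))" if "(\<Union>i. A i) \<subseteq> M" for A :: "nat \<Rightarrow> 'a set"
  proof -
    define B where "B = disjointed A"
    have "\<mu> (\<Union>i. A i) = \<mu> (\<Union>i. B i)"
      by (simp add: B_def UN_disjointed_eq)
    also have "\<dots> \<le> (\<Sum>i. \<mu> (B i))"
    proof -
      have "range B \<subseteq> Pow M"
        using that disjointed_subset[of A] by (fastforce simp: B_def)
      moreover have "disjoint_family B"
        unfolding B_def by (rule disjoint_family_disjointed)
      ultimately show ?thesis
        using oms unfolding outer_measure_space_def countably_subadditive_def by blast
    qed
    also have "\<dots> \<le> (\<Sum>i. \<mu> (A i))"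
      using that disjointed_subset[of A]
      by (intro suminf_le summableI mono) (auto simp: B_def)
    finally show ?thesis .
  qed
  have sub: "\<mu> (A \<union> B) \<le> \<mu> A + \<mu> B" if "A \<subseteq> M" "B \<subseteq> M" for A B
  proof -
    define S :: "nat \<Rightarrow> 'a set" where "S i = (if i = 0 then A else if i = 1 then B else {})" for i
    have "(\<Union>i. S i) = A \<union> B"
      by (auto simp: S_def split: if_splits)
    then have "\<mu> (A \<union> B) \<le> (\<Sum>i. \<mu> (S i))"
      using csub[of S] that by auto
    also have "(\<Sum>i. \<mu> (S i)) = (\<Sum>i<2. \<mu> (S i))"
      by (intro suminf_finite) (auto simp: S_def empty)
    finally show ?thesis
      by (simp add: S_def numeral_2_eq_2)
  qed
  have key: "\<mu> (X \<inter> F) + \<mu> (X - F) \<le> \<mu> X" if X: "X \<subseteq> M" "\<mu> X < top" for X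
  proof -
    define Y where "Y n = {x \<in> X. 1 / Suc n \<le> infdist x F}" for n
    define R where "R n = Y (Suc n) - Y n" for n
    have YX: "Y n \<subseteq> X" for n
      by (auto simp: Y_def)
    have RX: "R n \<subseteq> X" for n
      by (auto simp: Y_def R_def)
    have split: "\<mu> (X \<inter> F) + \<mu> (Y n) \<le> \<mu> X" for n
    proof -
      have "\<mu> (X \<inter> F) + \<mu> (Y n) \<le> \<mu> ((X \<inter> F) \<union> Y n)"
      proof (rule separated[of "1 / Suc n"])
        fix x y assume "x \<in> X \<inter> F" "y \<in> Y n"
        then show "1 / Suc n \<le> dist x y"
          using infdist_le[of x F y] by (auto simp: Y_def dist_commute)
      qed simp
      also have "\<dots> \<le> \<mu> X"
        using YX X by (intro mono) auto
      finally show ?thesis .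
    qed
    have R_far: "1 / real (Suc (Suc i)) - 1 / real (Suc (Suc (Suc i))) \<le> dist x y"
      if "x \<in> R i" "y \<in> R j" "Suc (Suc i) \<le> j" for x y i j
    proof -
      have "1 / real (Suc (Suc i)) \<le> infdist x F" "infdist y F < 1 / real (Suc j)"
        using that by (auto simp: R_def Y_def)
      moreover have "1 / real (Suc j) \<le> 1 / real (Suc (Suc (Suc i)))"
        using that by (intro divide_left_mono) auto
      moreover have "infdist x F \<le> infdist y F + dist x y"
        by (rule infdist_triangle)
      ultimately show ?thesis by linarith
    qed
    have R_sum: "(\<Sum>i<n. \<mu> (R (2 * i + c))) \<le> \<mu> (\<Union>i<n. R (2 * i + c))" for n c
    proof (induction n)
      case (Suc n)
      have "(\<Sum>i<Suc n. \<mu> (R (2 * i + c))) \<le> \<mu> (\<Union>i<n. R (2 * i + c)) + \<mu> (R (2 * n + c))"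
        using Suc by (simp add: add_right_mono)
      also have "\<dots> \<le> \<mu> ((\<Union>i<n. R (2 * i + c)) \<union> R (2 * n + c))"
      proof (rule separated)
        let ?e = "1 / real (Suc (Suc (2 * n + c))) - 1 / real (Suc (Suc (Suc (2 * n + c))))"
        show "0 < ?e"
          using divide_strict_left_mono[of "real (Suc (Suc (2 * n + c)))"
              "real (Suc (Suc (Suc (2 * n + c))))" 1] by simp
        fix x y assume "x \<in> (\<Union>i<n. R (2 * i + c))" and y: "y \<in> R (2 * n + c)"
        then obtain i where i: "i < n" "x \<in> R (2 * i + c)"
          by auto
        have "?e \<le> 1 / real (Suc (Suc (2 * i + c))) - 1 / real (Suc (Suc (Suc (2 * i + c))))"
        proof -
          have eq: "1 / real (Suc (Suc k)) - 1 / real (Suc (Suc (Suc k)))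
              = 1 / (real (Suc (Suc k)) * real (Suc (Suc (Suc k))))" for k
            by (simp add: field_simps)
          show ?thesis
            unfolding eq using i(1) by (intro divide_left_mono mult_mono mult_pos_pos) auto
        qed
        also have "\<dots> \<le> dist x y"
          using i y by (intro R_far) auto
        finally show "?e \<le> dist x y" .
      qed
      also have "(\<Union>i<n. R (2 * i + c)) \<union> R (2 * n + c) = (\<Union>i<Suc n. R (2 * i + c))"
        by (auto simp: less_Suc_eq)
      finally show ?case .
    qed (simp add: empty)
    have R_sum': "(\<Sum>i<n. \<mu> (R (2 * i + c))) \<le> \<mu> X" for n c
      by (rule order_trans[OF R_sum]) (use RX X in \<open>auto intro!: mono\<close>)
    have "(\<Sum>i<n. \<mu> (R i)) \<le> 2 * \<mu> X" for n
    proof -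
      have "(\<Sum>i<n. \<mu> (R i)) \<le> (\<Sum>i<2 * n. \<mu> (R i))"
        by (intro sum_mono2) auto
      also have "\<dots> = (\<Sum>i<n. \<mu> (R (2 * i + 0))) + (\<Sum>i<n. \<mu> (R (2 * i + 1)))"
        by (induction n) (simp_all add: algebra_simps)
      also have "\<dots> \<le> \<mu> X + \<mu> X"
        by (intro add_mono R_sum')
      finally show ?thesis
        by (simp add: mult_2)
    qed
    then have "(\<Sum>i. \<mu> (R i)) \<le> 2 * \<mu> X"
      by (intro suminf_le_const summableI)
    then have fin: "(\<Sum>i. \<mu> (R i)) < top"
      using X(2) by (auto simp: ennreal_mult_less_top intro: le_less_trans)
    have "\<mu> (X \<inter> F) + \<mu> (X - F) \<le> \<mu> X + (\<Sum>i. \<mu> (R (i + n)))" for n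
    proof -
      have "X - F \<subseteq> Y n \<union> (\<Union>i. R (i + n))"
      proof
        fix x assume x: "x \<in> X - F"
        then have "0 < infdist x F"
          using \<open>closed F\<close> False by (simp add: infdist_pos_not_in_closed)
        then obtain m where "inverse (real (Suc m)) < infdist x F"
          using reals_Archimedean by blast
        then have ex: "\<exists>m. x \<in> Y m"
          using x by (auto simp: Y_def inverse_eq_divide intro: less_imp_le)
        define m where "m = (LEAST m. x \<in> Y m)"
        have m: "x \<in> Y m"
          unfolding m_def using ex by (rule LeastI_ex)
        show "x \<in> Y n \<union> (\<Union>i. R (i + n))"
        proof (cases "m \<le> n")
          case True
          have "1 / real (Suc n) \<le> 1 / real (Suc m)"
            using True by (intro divide_left_mono) auto
          then show ?thesis
            using m by (auto simp: Y_def)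
        next
          case False
          then have "x \<notin> Y (m - 1)"
            unfolding m_def by (intro not_less_Least) auto
          then have "x \<in> R (m - 1 - n + n)"
            using m False by (auto simp: R_def)
          then show ?thesis by blast
        qed
      qed
      moreover have RM: "(\<Union>i. R (i + n)) \<subseteq> M" and YM: "Y n \<subseteq> M"
        using X RX YX by blast+
      ultimately have "\<mu> (X - F) \<le> \<mu> (Y n \<union> (\<Union>i. R (i + n)))"
        by (intro mono) auto
      also have "\<dots> \<le> \<mu> (Y n) + \<mu> (\<Union>i. R (i + n))"
        using RM YM by (intro sub)
      also have "\<dots> \<le> \<mu> (Y n) + (\<Sum>i. \<mu> (R (i + n)))"
        using RM by (intro add_left_mono csub)
      finally have "\<mu> (X \<inter> F) + \<mu> (X - F) \<le> (\<mu> (X \<inter> F) + \<mu> (Y n)) + (\<Sum>i. \<mu> (R (i + n)))"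
        by (simp add: add.assoc add_left_mono)
      also have "\<dots> \<le> \<mu> X + (\<Sum>i. \<mu> (R (i + n)))"
        by (intro add_right_mono split)
      finally show ?thesis .
    qed
    moreover have "(\<lambda>n. \<Sum>i. \<mu> (R (i + n))) \<longlonglongrightarrow> 0"
    proof -
      have "\<mu> (R i) < top" for i
        using fin by (rule ennreal_suminf_lessD)
      then have eq: "\<mu> (R i) = ennreal (enn2real (\<mu> (R i)))" for i
        by simp
      have nn: "0 \<le> enn2real (\<mu> (R i))" for i
        by simp
      have summ: "summable (\<lambda>i. enn2real (\<mu> (R i)))"
        using fin by (subst (asm) eq) (intro summable_suminf_not_top, auto)
      have "(\<Sum>i. \<mu> (R (i + n))) = ennreal (\<Sum>i. enn2real (\<mu> (R (i + n))))" for n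
        by (subst eq, intro suminf_ennreal2 summable_ignore_initial_segment summ) simp
      moreover have "(\<lambda>n. ennreal (\<Sum>i. enn2real (\<mu> (R (i + n))))) \<longlonglongrightarrow> ennreal 0"
        by (intro tendsto_ennrealI suminf_exist_split2 summ)
      ultimately show ?thesis
        by simp
    qed
    then have "(\<lambda>n. \<mu> X + (\<Sum>i. \<mu> (R (i + n)))) \<longlonglongrightarrow> \<mu> X + 0"
      by (intro tendsto_add tendsto_const)
    ultimately show ?thesis
      by (intro LIMSEQ_le_const[where X = "\<lambda>n. \<mu> X + (\<Sum>i. \<mu> (R (i + n)))"]) auto
  qed
  show ?thesis
    unfolding lambda_system_def
  proof (intro CollectI conjI ballI)
    fix X assume "X \<in> Pow M"
    then have X: "X \<subseteq> M"
      by simp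
    have eqs: "M \<inter> F \<inter> X = X \<inter> F" "(M - M \<inter> F) \<inter> X = X - F"
      using X by auto
    have "\<mu> X \<le> \<mu> (X \<inter> F) + \<mu> (X - F)"
      using sub[of "X \<inter> F" "X - F"] X by (metis Diff_subset Int_Diff_Un Int_lower1 order_trans)
    moreover have "\<mu> (X \<inter> F) + \<mu> (X - F) \<le> \<mu> X"
      using key[OF X] by (cases "\<mu> X < top") (auto simp: not_less top_unique)
    ultimately show "\<mu> (M \<inter> F \<inter> X) + \<mu> ((M - M \<inter> F) \<inter> X) = \<mu> X"
      unfolding eqs by (rule antisym[rotated])
  qed simp
qed

lemma measure_space_hausdorff:
  "measure_space M (sets (restrict_space borel M)) (hausdorff_outer d :: 'a::metric_space set \<Rightarrow> ennreal)"
proof -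
  define L where "L = lambda_system M (Pow M) (hausdorff_outer d)"
  interpret P: sigma_algebra M "Pow M"
    by (rule sigma_algebra_Pow)
  have ms: "measure_space M L (hausdorff_outer d)"
    unfolding L_def by (rule P.caratheodory_lemma[OF outer_measure_space_hausdorff])
  then interpret L: sigma_algebra M L
    by (simp add: measure_space_def)
  have "M \<inter> B \<in> L" if "B \<in> sets borel" for B
  proof -
    have "B \<in> sigma_sets UNIV (Collect closed)"
      using that by (simp add: borel_eq_closed sets_measure_of)
    then show ?thesis
    proof induction
      case (Basic F)
      then show ?case
        unfolding L_def
        by (intro closed_in_lambda_system[OF outer_measure_space_hausdorff hausdorff_outer_separated]) simp_all
    next
      case (Compl B)
      then have "M - M \<inter> B \<in> L"
        by auto
      moreover have "M - M \<inter> B = M \<inter> (UNIV - B)"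
        by blast
      ultimately show ?case
        by simp
    next
      case (Union B)
      then have "(\<Union>i. M \<inter> B i) \<in> L"
        by (intro L.countable_UN) auto
      then show ?case
        by simp
    qed simp
  qed
  then have sub: "sets (restrict_space borel M) \<subseteq> L"
    by (auto simp: sets_restrict_space)
  have "sigma_algebra M (sets (restrict_space borel M))"
    using sets.sigma_algebra_axioms[of "restrict_space borel M"] by (simp add: space_restrict_space)
  moreover have "positive (sets (restrict_space borel M)) (hausdorff_outer d)"
    using ms by (simp add: measure_space_def positive_def)
  moreover have "countably_additive (sets (restrict_space borel M)) (hausdorff_outer d)"
    using ms sub by (meson measure_space_def countably_additive_def order_trans subsetD)
  ultimately show ?thesis
    by (simp add: measure_space_def)
qed

lemma space_volume_measure [simp]: "space (volume_measure d M) = M"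
  unfolding volume_measure_def by (rule space_measure_of_conv)

lemma sets_volume_measure [simp, measurable_cong]:
  "sets (volume_measure d M) = sets (restrict_space borel M)"
proof -
  have sp: "space (restrict_space borel M) = M"
    by (simp add: space_restrict_space)
  show ?thesis
    unfolding volume_measure_def
    using sets.sigma_sets_eq[of "restrict_space borel M", unfolded sp]
      sets_measure_of[OF sets.space_closed[of "restrict_space borel M", unfolded sp]]
    by metis
qed

lemma emeasure_volume_measure:
  "A \<in> sets (restrict_space borel M) \<Longrightarrow> emeasure (volume_measure d M) A = hausdorff_outer d A"
  using measure_space_hausdorff[of M d] unfolding volume_measure_def measure_space_def
  by (intro emeasure_measure_of_sigma) blast+


section \<open>Samples and tests\<close>

definition two_level_law :: "'a measure \<Rightarrow> 'a set \<Rightarrow> 'a set \<Rightarrow> real \<Rightarrow> real \<Rightarrow> 'a measure" where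
  "two_level_law \<nu> V G f\<^sub>V f\<^sub>G =
     density \<nu> (\<lambda>x. ennreal (f\<^sub>V * indicator V x + f\<^sub>G * indicator G x))"

definition iid_sample :: "nat \<Rightarrow> 'a measure \<Rightarrow> (nat \<Rightarrow> 'a) measure" where
  "iid_sample n P = PiM {1..n} (\<lambda>_. P)"

text \<open>A test maps a sample to the probability of rejecting the null hypothesis;
  the nonrandomised tests are the indicator functions of rejection regions.\<close>

definition is_test :: "nat \<Rightarrow> 'a measure \<Rightarrow> ((nat \<Rightarrow> 'a) \<Rightarrow> real) \<Rightarrow> bool" where
  "is_test n S \<phi> \<longleftrightarrow> \<phi> \<in> borel_measurable (PiM {1..n} (\<lambda>_. S)) \<and>
     (\<forall>x\<in>space (PiM {1..n} (\<lambda>_. S)). 0 \<le> \<phi> x \<and> \<phi> x \<le> 1)"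

definition type_I_error :: "nat \<Rightarrow> 'a measure \<Rightarrow> ((nat \<Rightarrow> 'a) \<Rightarrow> real) \<Rightarrow> real" where
  "type_I_error n P\<^sub>0 \<phi> = (\<integral>x. \<phi> x \<partial>iid_sample n P\<^sub>0)"

definition type_II_error :: "nat \<Rightarrow> 'a measure \<Rightarrow> ((nat \<Rightarrow> 'a) \<Rightarrow> real) \<Rightarrow> real" where
  "type_II_error n P\<^sub>1 \<phi> = (\<integral>x. (1 - \<phi> x) \<partial>iid_sample n P\<^sub>1)"

end

theory Submission
  imports Defs
begin

text \<open>Le Cam's second moment argument. Let \<open>L\<close> be the density of the alternative with
  respect to the null law, and let \<open>a\<close> be the null probability of \<open>G\<close>. Then
  \<open>E\<^sub>0 L\<^sup>2 = 1 + \<delta>\<^sup>2 a (1 - a) / (1 - \<delta> a)\<^sup>2 \<le> 1 + K \<delta>\<^sup>2\<close> with \<open>K\<close> depending on \<open>a\<close> only,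
  so the \<open>n\<close>-fold likelihood ratio has second moment at most \<open>exp (K n \<delta>\<^sup>2)\<close>, which stays
  bounded along a subsequence. By Cauchy--Schwarz, tests whose type I error
  tends to 0 then have power tending to 0 along this subsequence.\<close>

section \<open>Densities on product spaces\<close>

text \<open>A product measure is determined by its values on boxes, and there the integral of a
  product over separate coordinates factorises. This turns the likelihood ratio of one observation
  into that of the whole sample.\<close>

lemma PiM_density:
  assumes "finite I" "prob_space M" and f [measurable]: "f \<in> borel_measurable M"
    and "prob_space (density M f)"
  shows "PiM I (\<lambda>_. density M f) = density (PiM I (\<lambda>_. M)) (\<lambda>x. \<Prod>i\<in>I. f (x i))"
proof -
  interpret M: prob_space M by fact
  interpret D: prob_space "density M f" by fact
  interpret PM: product_sigma_finite "\<lambda>_. M" ..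
  interpret PD: product_sigma_finite "\<lambda>_. density M f" ..
  show ?thesis
  proof (rule PD.PiM_eqI[symmetric])
    show "sets (density (PiM I (\<lambda>_. M)) (\<lambda>x. \<Prod>i\<in>I. f (x i))) = sets (PiM I (\<lambda>_. density M f))"
      by (simp cong: sets_PiM_cong)
    fix A assume "\<And>i. i \<in> I \<Longrightarrow> A i \<in> sets (density M f)"
    then have A [measurable]: "\<And>i. i \<in> I \<Longrightarrow> A i \<in> sets M"
      by simp
    \<comment> \<open>Restricted to points of the product space, because membership in
      \<open>Pi\<^sub>E I A\<close> also demands the value \<open>undefined\<close> off
      \<open>I\<close>.\<close>
    have ind: "indicator (Pi\<^sub>E I A) x = (\<Prod>i\<in>I. indicator (A i) (x i) :: ennreal)"
      if "x \<in> space (PiM I (\<lambda>_. M))" for x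
    proof (cases "\<forall>i\<in>I. x i \<in> A i")
      case True
      then show ?thesis
        using that by (auto simp: space_PiM PiE_def indicator_def)
    next
      case False
      then have "(\<Prod>i\<in>I. indicator (A i) (x i) :: ennreal) = 0"
        using \<open>finite I\<close> by (auto simp: indicator_def)
      then show ?thesis
        using False by (auto simp: indicator_def)
    qed
    have meas: "Pi\<^sub>E I A \<in> sets (PiM I (\<lambda>_. M))"
      using A \<open>finite I\<close> by (intro sets_PiM_I_finite) auto
    have [measurable]: "(\<lambda>x. \<Prod>i\<in>I. f (x i)) \<in> borel_measurable (PiM I (\<lambda>_. M))"
      by measurable
    have "emeasure (density (PiM I (\<lambda>_. M)) (\<lambda>x. \<Prod>i\<in>I. f (x i))) (Pi\<^sub>E I A)
        = (\<integral>\<^sup>+x. (\<Prod>i\<in>I. f (x i)) * indicator (Pi\<^sub>E I A) x \<partial>PiM I (\<lambda>_. M))"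
      using meas by (intro emeasure_density) auto
    also have "\<dots> = (\<integral>\<^sup>+x. (\<Prod>i\<in>I. f (x i) * indicator (A i) (x i)) \<partial>PiM I (\<lambda>_. M))"
      by (intro nn_integral_cong) (simp add: ind prod.distrib)
    also have "\<dots> = (\<Prod>i\<in>I. \<integral>\<^sup>+x. f x * indicator (A i) x \<partial>M)"
      using \<open>finite I\<close> by (intro PM.product_nn_integral_prod) auto
    also have "\<dots> = (\<Prod>i\<in>I. emeasure (density M f) (A i))"
      by (intro prod.cong refl emeasure_density[symmetric]) auto
    finally show "emeasure (density (PiM I (\<lambda>_. M)) (\<lambda>x. \<Prod>i\<in>I. f (x i))) (Pi\<^sub>E I A)
        = (\<Prod>i\<in>I. emeasure (density M f) (A i))" .
  qed (rule \<open>finite I\<close>)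
qed

section \<open>Tests and their error probabilities\<close>

text \<open>Only the measurable structure enters \<open>is_test\<close>, so a test over the volume
  measure is also one over every law given by a density against it.\<close>

lemma is_test_cong_sets:
  assumes "sets S = sets T"
  shows "is_test n S \<phi> \<longleftrightarrow> is_test n T \<phi>"
proof -
  have eq: "sets (PiM {1..n} (\<lambda>_. S)) = sets (PiM {1..n} (\<lambda>_. T))"
    using assms by (intro sets_PiM_cong) auto
  show ?thesis
    unfolding is_test_def measurable_cong_sets[OF eq refl] sets_eq_imp_space_eq[OF eq] ..
qed

lemma prob_space_iid_sample: "prob_space P \<Longrightarrow> prob_space (iid_sample n P)"
  unfolding iid_sample_def by (intro prob_space_PiM)

lemma is_test_integrable:
  assumes "prob_space P" "is_test n P \<phi>"
  shows "integrable (iid_sample n P) \<phi>"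
proof -
  interpret prob_space "iid_sample n P"
    by (rule prob_space_iid_sample) fact
  show ?thesis
    using assms(2) by (intro integrable_const_bound[where B = 1]) (auto simp: is_test_def iid_sample_def)
qed

text \<open>\<open>type_I_error\<close> is the expectation of the test under whatever law is
  supplied, so at an alternative law it denotes the power.\<close>

lemma type_II_error_eq:
  assumes "prob_space P" "is_test n P \<phi>"
  shows "type_II_error n P \<phi> = 1 - type_I_error n P \<phi>"
proof -
  interpret prob_space "iid_sample n P"
    by (rule prob_space_iid_sample) fact
  show ?thesis
    unfolding type_II_error_def type_I_error_def
    using is_test_integrable[OF assms] by (simp add: prob_space)
qed

section \<open>Power bounded through the second moment of the likelihood ratio\<close>

text \<open>Minimising over \<open>t\<close> gives the Cauchy--Schwarz inequality.\<close>

lemma rejection_probability_density_le: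
  fixes h :: "'a \<Rightarrow> real"
  assumes P: "prob_space P" and h [measurable]: "h \<in> borel_measurable P" and h0: "\<And>x. 0 \<le> h x"
    and Q: "prob_space (density P (\<lambda>x. ennreal (h x)))"
    and h2: "integrable P (\<lambda>x. (h x)\<^sup>2)"
    and \<phi>: "is_test n P \<phi>" and t: "0 < t"
  shows "type_I_error n (density P (\<lambda>x. ennreal (h x))) \<phi>
      \<le> (t * (\<integral>x. (h x)\<^sup>2 \<partial>P) ^ n + type_I_error n P \<phi> / t) / 2"
proof -
  interpret P: prob_space P by fact
  interpret PM: product_sigma_finite "\<lambda>_. P" ..
  let ?S = "iid_sample n P"
  define H where "H x = (\<Prod>i\<in>{1..n}. h (x i))" for x
  have H_meas [measurable]: "H \<in> borel_measurable ?S"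
    unfolding H_def iid_sample_def by measurable
  have H0: "0 \<le> H x" for x
    unfolding H_def by (intro prod_nonneg) (simp add: h0)
  have \<phi>_meas [measurable]: "\<phi> \<in> borel_measurable ?S"
    and \<phi>01: "\<And>x. x \<in> space ?S \<Longrightarrow> 0 \<le> \<phi> x \<and> \<phi> x \<le> 1"
    using \<phi> by (auto simp: is_test_def iid_sample_def)
  have \<phi>_int: "integrable ?S \<phi>"
    by (rule is_test_integrable[OF P \<phi>])
  have H2: "(H x)\<^sup>2 = (\<Prod>i\<in>{1..n}. (h (x i))\<^sup>2)" for x
    by (simp add: H_def prod_power_distrib)
  have H2_int: "integrable ?S (\<lambda>x. (H x)\<^sup>2)"
    unfolding H2 iid_sample_def using h2 by (intro PM.product_integrable_prod) auto
  have H2_eq: "(\<integral>x. (H x)\<^sup>2 \<partial>?S) = (\<integral>x. (h x)\<^sup>2 \<partial>P) ^ n"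
    unfolding H2 iid_sample_def using h2 by (subst PM.product_integral_prod) auto
  have dens: "iid_sample n (density P (\<lambda>x. ennreal (h x))) = density ?S (\<lambda>x. ennreal (H x))"
    unfolding iid_sample_def H_def using P Q
    by (subst PiM_density) (simp_all add: prod_ennreal h0)
  \<comment> \<open>Weighted AM-GM: expand \<open>(t * H x - \<phi> x)\<^sup>2 / t\<close>, which is
    nonnegative, and use that the square of a number in [0, 1] is at most the number itself.\<close>
  have pt: "H x * \<phi> x \<le> (t * (H x)\<^sup>2 + \<phi> x / t) / 2" if "x \<in> space ?S" for x
  proof -
    have "0 \<le> (t * H x - \<phi> x)\<^sup>2 / t"
      using t by simp
    also have "\<dots> = t * (H x)\<^sup>2 - 2 * (H x * \<phi> x) + (\<phi> x)\<^sup>2 / t"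
      using t by (simp add: field_simps power2_eq_square)
    also have "(\<phi> x)\<^sup>2 / t \<le> \<phi> x / t"
      using \<phi>01[OF that] t by (intro divide_right_mono) (auto simp: power2_eq_square mult_left_le)
    finally show ?thesis
      by simp
  qed
  have "type_I_error n (density P (\<lambda>x. ennreal (h x))) \<phi> = (\<integral>x. H x * \<phi> x \<partial>?S)"
    unfolding type_I_error_def dens using H0 by (subst integral_density) auto
  also have "\<dots> \<le> (\<integral>x. (t * (H x)\<^sup>2 + \<phi> x / t) / 2 \<partial>?S)"
    using H2_int \<phi>_int pt H0 \<phi>01 t
    by (intro integral_mono') (auto intro!: add_nonneg_nonneg)
  also have "\<dots> = (t * (\<integral>x. (h x)\<^sup>2 \<partial>P) ^ n + type_I_error n P \<phi> / t) / 2"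
    using H2_int \<phi>_int by (simp add: H2_eq type_I_error_def)
  finally show ?thesis .
qed

section \<open>Second moment of a two-level density\<close>

text \<open>If \<open>G\<close> has full measure, the bound reads \<open>1\<close>, by \<open>x / 0 = 0\<close>; this is correct, as the
  density is then 1 almost everywhere.\<close>

lemma two_level_second_moment_le:
  fixes c \<delta> :: real and V G :: "'a set"
  defines "h \<equiv> \<lambda>x. c * indicator V x + (1 - \<delta>) * c * indicator G x"
  assumes "prob_space P" and G [measurable]: "G \<in> sets P" and V: "V = space P - G"
    and c: "0 \<le> c" and \<delta>: "0 \<le> \<delta>" "\<delta> \<le> 1"
    and Q: "prob_space (density P (\<lambda>x. ennreal (h x)))"
  shows "integrable P (\<lambda>x. (h x)\<^sup>2)"
    and "(\<integral>x. (h x)\<^sup>2 \<partial>P) \<le> 1 + measure P G / (1 - measure P G) * \<delta>\<^sup>2"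
proof -
  interpret P: prob_space P by fact
  interpret Q: prob_space "density P (\<lambda>x. ennreal (h x))" by fact
  define a where "a = measure P G"
  have a: "0 \<le> a" "a \<le> 1"
    by (simp_all add: a_def)
  have [measurable]: "V \<in> sets P"
    by (simp add: V)
  have mV: "measure P V = 1 - a"
    unfolding V a_def by (rule P.prob_compl) fact
  have [measurable]: "h \<in> borel_measurable P"
    unfolding h_def by measurable
  have h0: "0 \<le> h x" for x
    using c \<delta> by (auto simp: h_def indicator_def)
  have intV: "integrable P (indicator V :: _ \<Rightarrow> real)" and intG: "integrable P (indicator G :: _ \<Rightarrow> real)"
    by (simp_all add: P.emeasure_finite less_top[symmetric])
  have sq: "(h x)\<^sup>2 = c\<^sup>2 * indicator V x + ((1 - \<delta>) * c)\<^sup>2 * indicator G x" for x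
    by (auto simp: h_def V indicator_def)
  show "integrable P (\<lambda>x. (h x)\<^sup>2)"
    unfolding sq using intV intG by (intro Bochner_Integration.integrable_add integrable_mult_right)
  have "(\<integral>x. h x \<partial>P) = (\<integral>x. 1 \<partial>density P (\<lambda>x. ennreal (h x)))"
    using h0 by (subst integral_density) auto
  also have "\<dots> = 1"
    using Q.prob_space by simp
  finally have "(\<integral>x. h x \<partial>P) = 1" .
  then have norm: "c * (1 - \<delta> * a) = 1"
    unfolding h_def using intV intG mV by (simp add: a_def[symmetric] algebra_simps)
  have "(\<integral>x. (h x)\<^sup>2 \<partial>P) = c\<^sup>2 * (1 - a) + ((1 - \<delta>) * c)\<^sup>2 * a"
    unfolding sq using intV intG mV by (simp add: a_def)
  \<comment> \<open>Squared mean plus variance; by \<open>norm\<close> the mean is 1.\<close>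
  also have "\<dots> = (c * (1 - \<delta> * a))\<^sup>2 + c\<^sup>2 * (a * (1 - a) * \<delta>\<^sup>2)"
    by (simp add: power2_eq_square algebra_simps)
  also have "\<dots> = 1 + c\<^sup>2 * (a * (1 - a) * \<delta>\<^sup>2)"
    using norm by simp
  also have "\<dots> \<le> 1 + a / (1 - a) * \<delta>\<^sup>2"
  proof (cases "a = 1")
    case False
    then have a1: "0 < 1 - a"
      using a by simp
    \<comment> \<open>As \<open>\<delta>\<close> is at most 1, \<open>norm\<close> bounds the level
      \<open>c\<close> by \<open>1 / (1 - a)\<close>, which no longer involves
      \<open>\<delta>\<close>. One constant therefore serves all sample sizes.\<close>
    have "\<delta> * a \<le> a"
      using a \<delta> by (simp add: mult_left_le_one_le)
    then have "c * (1 - a) \<le> 1"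
      using c norm by (metis diff_left_mono mult_left_mono)
    then have "c \<le> 1 / (1 - a)"
      using a1 by (simp add: pos_le_divide_eq)
    then have "c\<^sup>2 \<le> (1 / (1 - a))\<^sup>2"
      using c by (intro power_mono)
    then have "c\<^sup>2 * (a * (1 - a) * \<delta>\<^sup>2) \<le> (1 / (1 - a))\<^sup>2 * (a * (1 - a) * \<delta>\<^sup>2)"
      using a by (intro mult_right_mono) auto
    also have "\<dots> = a / (1 - a) * \<delta>\<^sup>2"
      using a1 by (simp add: power2_eq_square)
    finally show ?thesis
      by simp
  qed simp
  finally show "(\<integral>x. (h x)\<^sup>2 \<partial>P) \<le> 1 + measure P G / (1 - measure P G) * \<delta>\<^sup>2"
    by (simp add: a_def)
qed

section \<open>Two-level laws relative to the uniform law\<close>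

text \<open>\<open>ennreal\<close> sends nonpositive reals to 0, so a nonpositive level would leave
  total mass 0 instead of 1. It is applied with \<open>s\<close> equal to 1 for the null law and to
  \<open>1 - \<delta> n\<close> for the alternative.\<close>

lemma two_level_law_level_pos:
  assumes "prob_space (two_level_law \<nu> V G c (s * c))" "0 \<le> s"
  shows "0 < c"
proof (rule ccontr)
  assume "\<not> 0 < c"
  then have "c \<le> 0" "s * c \<le> 0"
    using assms(2) by (auto intro: mult_nonneg_nonpos)
  then have "c * indicator V x + s * c * indicator G x \<le> 0" for x
    by (auto simp: indicator_def)
  then have "two_level_law \<nu> V G c (s * c) = density \<nu> (\<lambda>_. 0)"
    by (simp add: two_level_law_def ennreal_neg)
  moreover have "emeasure (two_level_law \<nu> V G c (s * c)) (space (two_level_law \<nu> V G c (s * c))) = 1"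
    using assms(1) by (rule prob_space.emeasure_space_1)
  ultimately show False
    by (simp add: emeasure_density)
qed

text \<open>The likelihood ratio against the uniform law is again a two-level function: divide both
  heights by the uniform level \<open>b\<close>.\<close>

lemma two_level_law_uniform_density:
  assumes G [measurable]: "G \<in> sets \<nu>" and V: "V = space \<nu> - G" and b: "0 < b"
  shows "two_level_law \<nu> V G c d
    = density (two_level_law \<nu> V G b b) (\<lambda>x. ennreal (c / b * indicator V x + d / b * indicator G x))"
proof -
  have [measurable]: "V \<in> sets \<nu>"
    by (simp add: V)
  show ?thesis
    unfolding two_level_law_def
  proof (subst density_density_eq, measurable, intro density_cong AE_I2)
    fix x assume "x \<in> space \<nu>"
    then show "ennreal (c * indicator V x + d * indicator G x)
        = ennreal (b * indicator V x + b * indicator G x)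
          * ennreal (c / b * indicator V x + d / b * indicator G x)"
      using b by (auto simp: V indicator_def ennreal_mult'[symmetric])
  qed measurable
qed

section \<open>Impossibility of consistent separation\<close>

theorem theorem4:
  fixes M :: "(real ^ 'D) set" and d :: nat
    and C :: "nat \<Rightarrow> (real ^ 'D) set" and k :: nat
    and V G :: "(real ^ 'D) set"
    and \<delta> :: "nat \<Rightarrow> real"
    and f\<^sub>0 :: real and f\<^sub>V f\<^sub>G :: "nat \<Rightarrow> real"
  defines "vol \<equiv> volume_measure d M"
  assumes "embedded_submanifold d M"
    and "0 < emeasure vol M" and "emeasure vol M < \<infinity>"
    and "\<And>i. i \<in> {1..k} \<Longrightarrow> C i \<subseteq> M"
    and "\<And>i. i \<in> {1..k} \<Longrightarrow> C i \<in> sets vol"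
    and "disjoint_family_on C {1..k}"
    and "V = (\<Union>i\<in>{1..k}. C i)" and "G = M - V"
    and "prob_space (two_level_law vol V G f\<^sub>0 f\<^sub>0)"
    and "\<And>n. n \<ge> 1 \<Longrightarrow> 0 < \<delta> n \<and> \<delta> n \<le> 1"
    and "\<And>n. n \<ge> 1 \<Longrightarrow> f\<^sub>G n = (1 - \<delta> n) * f\<^sub>V n"
    and "\<And>n. n \<ge> 1 \<Longrightarrow> prob_space (two_level_law vol V G (f\<^sub>V n) (f\<^sub>G n))"
    and "\<not> filterlim (\<lambda>n. real n * (\<delta> n)\<^sup>2) at_top sequentially"
  shows "\<not> (\<exists>\<phi>. (\<forall>n\<ge>1. is_test n vol (\<phi> n)) \<and>
    (\<lambda>n. type_I_error n (two_level_law vol V G f\<^sub>0 f\<^sub>0) (\<phi> n)) \<longlonglongrightarrow> 0 \<and>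
    (\<lambda>n. type_II_error n (two_level_law vol V G (f\<^sub>V n) (f\<^sub>G n)) (\<phi> n)) \<longlonglongrightarrow> 0)"
proof
  define P\<^sub>0 where "P\<^sub>0 = two_level_law vol V G f\<^sub>0 f\<^sub>0"
  define P\<^sub>1 where "P\<^sub>1 n = two_level_law vol V G (f\<^sub>V n) (f\<^sub>G n)" for n
  assume "\<exists>\<phi>. (\<forall>n\<ge>1. is_test n vol (\<phi> n)) \<and>
    (\<lambda>n. type_I_error n (two_level_law vol V G f\<^sub>0 f\<^sub>0) (\<phi> n)) \<longlonglongrightarrow> 0 \<and>
    (\<lambda>n. type_II_error n (two_level_law vol V G (f\<^sub>V n) (f\<^sub>G n)) (\<phi> n)) \<longlonglongrightarrow> 0"
  then obtain \<phi> where \<phi>: "\<And>n. n \<ge> 1 \<Longrightarrow> is_test n vol (\<phi> n)"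
    and I: "(\<lambda>n. type_I_error n P\<^sub>0 (\<phi> n)) \<longlonglongrightarrow> 0"
    and II: "(\<lambda>n. type_II_error n (P\<^sub>1 n) (\<phi> n)) \<longlonglongrightarrow> 0"
    unfolding P\<^sub>0_def P\<^sub>1_def by blast
  have space_vol: "space vol = M"
    by (simp add: vol_def)
  have V_sets: "V \<in> sets vol"
    using assms(6,8) by auto
  then have G_sets: "G \<in> sets vol" and V_eq: "V = space vol - G"
    using sets.sets_into_space[OF V_sets] by (auto simp: assms(9) space_vol[symmetric])
  have sets_P\<^sub>0: "sets P\<^sub>0 = sets vol" and space_P\<^sub>0: "space P\<^sub>0 = space vol"
    and sets_P\<^sub>1: "sets (P\<^sub>1 n) = sets vol" for n
    by (simp_all add: P\<^sub>0_def P\<^sub>1_def two_level_law_def)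
  have P\<^sub>0: "prob_space P\<^sub>0"
    using assms(10) by (simp add: P\<^sub>0_def)
  have f\<^sub>0: "0 < f\<^sub>0"
    using two_level_law_level_pos[of vol V G f\<^sub>0 1] assms(10) by simp
  \<comment> \<open>The null mass of \<open>G\<close> does not vary with \<open>n\<close>, hence
    neither does \<open>K\<close>. If that mass is 1, then \<open>K\<close> is 0 by division by
    zero.\<close>
  define K where "K = measure P\<^sub>0 G / (1 - measure P\<^sub>0 G)"
  have K: "0 \<le> K"
    unfolding K_def using prob_space.prob_le_1[OF P\<^sub>0] by simp

  have bound: "1 - type_II_error n (P\<^sub>1 n) (\<phi> n)
      \<le> (t * exp (K * (real n * (\<delta> n)\<^sup>2)) + type_I_error n P\<^sub>0 (\<phi> n) / t) / 2"
    if n: "n \<ge> 1" and t: "0 < t" for n t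
  proof -
    define c where "c = f\<^sub>V n / f\<^sub>0"
    define h where "h x = c * indicator V x + (1 - \<delta> n) * c * indicator G x" for x
    have \<delta>: "0 \<le> \<delta> n" "\<delta> n \<le> 1"
      using assms(11)[OF n] by auto
    have P\<^sub>1: "prob_space (P\<^sub>1 n)"
      using assms(13)[OF n] by (simp add: P\<^sub>1_def)
    have "0 < f\<^sub>V n"
      using two_level_law_level_pos[of vol V G "f\<^sub>V n" "1 - \<delta> n"] P\<^sub>1 \<delta>
      by (simp add: P\<^sub>1_def assms(12)[OF n])
    then have c: "0 \<le> c"
      using f\<^sub>0 by (simp add: c_def)
    have P\<^sub>1_eq: "P\<^sub>1 n = density P\<^sub>0 (\<lambda>x. ennreal (h x))"
      unfolding P\<^sub>1_def P\<^sub>0_def h_def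
      using two_level_law_uniform_density[OF G_sets V_eq f\<^sub>0, of "f\<^sub>V n" "f\<^sub>G n"]
      by (simp add: c_def assms(12)[OF n])
    have Q: "prob_space (density P\<^sub>0 (\<lambda>x. ennreal (h x)))"
      using P\<^sub>1 by (simp add: P\<^sub>1_eq)
    have "G \<in> sets P\<^sub>0" and "V = space P\<^sub>0 - G" and "V \<in> sets P\<^sub>0"
      using G_sets V_eq V_sets by (simp_all add: sets_P\<^sub>0 space_P\<^sub>0)
    note h2 = two_level_second_moment_le[OF P\<^sub>0 this(1,2) c \<delta> Q[unfolded h_def], folded h_def K_def]
    have h_meas: "h \<in> borel_measurable P\<^sub>0"
      unfolding h_def using \<open>G \<in> sets P\<^sub>0\<close> \<open>V \<in> sets P\<^sub>0\<close> by measurable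
    have h0: "0 \<le> h x" for x
      using c \<delta> by (auto simp: h_def indicator_def)
    have test: "is_test n P\<^sub>0 (\<phi> n)" "is_test n (P\<^sub>1 n) (\<phi> n)"
      using \<phi>[OF n] is_test_cong_sets[OF sets_P\<^sub>0] is_test_cong_sets[OF sets_P\<^sub>1] by auto
    \<comment> \<open>Using \<open>1 + x \<le> exp x\<close> before taking the power makes the
      exponent linear in \<open>n\<close>.\<close>
    have "(\<integral>x. (h x)\<^sup>2 \<partial>P\<^sub>0) \<le> exp (K * (\<delta> n)\<^sup>2)"
      using h2(2) exp_ge_add_one_self[of "K * (\<delta> n)\<^sup>2"] by linarith
    then have "(\<integral>x. (h x)\<^sup>2 \<partial>P\<^sub>0) ^ n \<le> exp (K * (\<delta> n)\<^sup>2) ^ n"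
      by (intro power_mono integral_nonneg) auto
    also have "\<dots> = exp (K * (real n * (\<delta> n)\<^sup>2))"
      by (simp add: exp_of_nat_mult[symmetric] mult_ac)
    finally have pow: "t * (\<integral>x. (h x)\<^sup>2 \<partial>P\<^sub>0) ^ n \<le> t * exp (K * (real n * (\<delta> n)\<^sup>2))"
      using t by simp
    have "1 - type_II_error n (P\<^sub>1 n) (\<phi> n) = type_I_error n (P\<^sub>1 n) (\<phi> n)"
      using type_II_error_eq[OF P\<^sub>1 test(2)] by simp
    also have "\<dots> \<le> (t * (\<integral>x. (h x)\<^sup>2 \<partial>P\<^sub>0) ^ n + type_I_error n P\<^sub>0 (\<phi> n) / t) / 2"
      unfolding P\<^sub>1_eq by (rule rejection_probability_density_le[OF P\<^sub>0 h_meas h0 Q h2(1) test(1) t])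
    finally show ?thesis
      using pow by simp
  qed

  \<comment> \<open>The subsequence with bounded \<open>n * \<delta>\<^sup>2\<close> appears as a
    property holding for infinitely many \<open>n\<close>.\<close>
  obtain B where B: "\<exists>\<^sub>F n in sequentially. real n * (\<delta> n)\<^sup>2 < B"
    using assms(14) unfolding filterlim_at_top frequently_def by (auto simp: not_less)
  \<comment> \<open>Chosen so that \<open>t * exp (K * B)\<close> equals 1; one fixed
    \<open>t\<close> suffices, without optimising in \<open>bound\<close>.\<close>
  define t where "t = exp (- (K * B))"
  have t: "0 < t"
    by (simp add: t_def)
  \<comment> \<open>With these thresholds, whenever \<open>n * \<delta>\<^sup>2 < B\<close> the
    power is below (1 + 1/4) / 2 = 5/8 by \<open>bound\<close>, yet above 3/4 by the type II
    error.\<close>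
  have "\<forall>\<^sub>F n in sequentially. type_I_error n P\<^sub>0 (\<phi> n) < t / 4"
    and "\<forall>\<^sub>F n in sequentially. type_II_error n (P\<^sub>1 n) (\<phi> n) < 1 / 4"
    using order_tendstoD(2)[OF I, of "t / 4"] order_tendstoD(2)[OF II, of "1 / 4"] t by simp_all
  then have "\<forall>\<^sub>F n in sequentially. \<not> real n * (\<delta> n)\<^sup>2 < B"
    using eventually_ge_at_top[of 1]
  proof eventually_elim
    case (elim n)
    show ?case
    proof
      assume "real n * (\<delta> n)\<^sup>2 < B"
      then have "K * (real n * (\<delta> n)\<^sup>2) \<le> K * B"
        using K by (intro mult_left_mono) auto
      then have "t * exp (K * (real n * (\<delta> n)\<^sup>2)) \<le> t * exp (K * B)"
        using t by simp
      also have "\<dots> = 1"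
        by (simp add: t_def exp_minus)
      finally have "t * exp (K * (real n * (\<delta> n)\<^sup>2)) \<le> 1" .
      moreover have "type_I_error n P\<^sub>0 (\<phi> n) / t < 1 / 4"
        using elim(1) t by (simp add: field_simps)
      ultimately show False
        using bound[OF elim(3) t] elim(2) by argo
    qed
  qed
  then show False
    using B by (simp add: frequently_def)
qed

end
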